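(* Let $d\geqslant 3$ be an integer. For all positive integers $w,z\geqslant 3^d$, we have $p_{A_d}(w)\,p_{A_d}(z)>p_{A_d}(w+z)$. If $d=2$, the inequality $p_{A_2}(w)\,p_{A_2}(z)>p_{A_2}(w+z)$ holds for all integers $w,z\geqslant 12$.
   Context: For an integer $d\geqslant2$, let $A_d=\{n^d:n\in\mathbb{N}_+\}$. The $d$-th power partition function $p_{A_d}(n)$ is the number of partitions of $n$ all of whose parts are perfect $d$-th powers of positive integers. *)

theory Defs
  imports Complex_Main "HOL-Library.Multiset"
begin

definition perfect_powers :: "nat \<Rightarrow> nat set" where
  "perfect_powers d = {n ^ d |n. n > 0}"

text \<open>
  A partition of \<open>n\<close> with parts in \<open>A\<close> is a finite multiset of elements of \<open>A\<close> with sum \<open>n\<close>.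
  There are only finitely many of them if \<open>0 \<notin> A\<close>, so that \<open>card\<close> then counts them.
\<close>

definition partitions_in :: "nat set \<Rightarrow> nat \<Rightarrow> nat multiset set" where
  "partitions_in A n = {P. set_mset P \<subseteq> A \<and> \<Sum>\<^sub># P = n}"

definition partition_fun :: "nat set \<Rightarrow> nat \<Rightarrow> nat" where
  "partition_fun A n = card (partitions_in A n)"

lemma finite_partitions_in:
  assumes "0 \<notin> A"
  shows "finite (partitions_in A n)"
proof -
  have size_le: "size P \<le> \<Sum>\<^sub># P" if "0 \<notin># P" for P :: "nat multiset"
    using that by (induction P) auto
  have "partitions_in A n \<subseteq> mset ` {xs. set xs \<subseteq> {..n} \<and> length xs \<le> n}"
  proof
    fix P assume "P \<in> partitions_in A n"
    then have P: "set_mset P \<subseteq> A" "\<Sum>\<^sub># P = n"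
      by (auto simp: partitions_in_def)
    obtain xs where xs: "P = mset xs"
      by (metis ex_mset)
    have "x \<le> n" if "x \<in># P" for x
      using that P(2) by (metis le_add1 sum_mset.remove)
    moreover have "size P \<le> n"
      using size_le[of P] P assms by auto
    ultimately show "P \<in> mset ` {xs. set xs \<subseteq> {..n} \<and> length xs \<le> n}"
      using xs by auto
  qed
  moreover have "finite (mset ` {xs. set xs \<subseteq> {..n} \<and> length xs \<le> n})"
    by (intro finite_imageI finite_lists_length_le) auto
  ultimately show ?thesis
    by (rule finite_subset)
qed

lemma zero_notin_perfect_powers: "0 \<notin> perfect_powers d"
  by (auto simp: perfect_powers_def)

end

theory Submission
  imports Defs
begin

text \<open>
  Write \<open>u = 2 ^ d\<close> and let \<open>F k n\<close> count the partitions of \<open>n\<close> with parts among \<open>1\<close>, \<open>u\<close> and the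
  powers \<open>j ^ d\<close> with \<open>j \<ge> k\<close>, so that \<open>F 3\<close> is the function in question. Splitting according to
  whether \<open>m = k ^ d\<close> occurs gives \<open>F k n = F (k + 1) n + F k (n - m)\<close>, and with it the inequality
  for \<open>(k, w, z)\<close> follows from those for \<open>(k + 1, w, z)\<close> and \<open>(k, w - m, z)\<close> whenever
  \<open>w \<ge> m + 2 u\<close>. Since it is the smallest part above \<open>u\<close> that is removed, what remains are pairs
  with \<open>w, z < m + 2 u\<close>, for which a partition of \<open>w + z\<close> has at most two parts exceeding \<open>u\<close>.
  There \<open>F k w\<close> and \<open>F k z\<close> are at least linear in \<open>w / u\<close> and \<open>z / u\<close>, while \<open>F k (w + z)\<close> is small because
  consecutive powers differ by at least \<open>2 u\<close>. The cases \<open>k = 3\<close>, \<open>d \<le> 3\<close>, where the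
  powers are too dense for this estimate, are computed.
\<close>

section \<open>Removing one part from a partition\<close>

lemma member_le_sum_mset: "a \<in># P \<Longrightarrow> a \<le> \<Sum>\<^sub># P" for a :: nat
  by (metis le_add1 sum_mset.remove)

text \<open>Adding one copy of \<open>a\<close> maps the partitions of \<open>n - a\<close>
  bijectively onto the partitions of \<open>n\<close> that contain \<open>a\<close>.\<close>

lemma partition_fun_remove:
  assumes "0 \<notin> A" "a \<in> A"
  shows "partition_fun A n =
    partition_fun (A - {a}) n + (if a \<le> n then partition_fun A (n - a) else 0)"
proof -
  let ?with = "{P \<in> partitions_in A n. a \<in># P}"
  let ?without = "partitions_in (A - {a}) n"
  have "partitions_in A n = ?without \<union> ?with"
    by (auto simp: partitions_in_def)
  moreover have "card (?without \<union> ?with) = card ?without + card ?with"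
  proof (rule card_Un_disjoint)
    show "finite ?without" "finite ?with"
      using assms by (simp_all add: finite_partitions_in)
    show "?without \<inter> ?with = {}"
      by (auto simp: partitions_in_def)
  qed
  moreover have "card ?with = (if a \<le> n then partition_fun A (n - a) else 0)"
  proof (cases "a \<le> n")
    case True
    have "?with = add_mset a ` partitions_in A (n - a)"
    proof (intro equalityI subsetI)
      fix P assume "P \<in> ?with"
      then obtain Q where "P = add_mset a Q" "P \<in> partitions_in A n"
        by (metis (mono_tags, lifting) mem_Collect_eq multi_member_split)
      then show "P \<in> add_mset a ` partitions_in A (n - a)"
        by (auto simp: partitions_in_def)
    qed (use True assms in \<open>auto simp: partitions_in_def\<close>)
    then show ?thesis
      using True by (simp add: card_image inj_on_def partition_fun_def)
  next
    case False
    have "?with = {}"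
      using False by (auto simp: partitions_in_def dest: member_le_sum_mset)
    then show ?thesis
      using False by (simp only: card.empty if_False)
  qed
  ultimately show ?thesis
    by (simp add: partition_fun_def)
qed

lemma partition_fun_cong_le:
  assumes "\<And>a. a \<le> n \<Longrightarrow> a \<in> A \<longleftrightarrow> a \<in> B"
  shows "partition_fun A n = partition_fun B n"
proof -
  have "partitions_in A n = partitions_in B n"
    using assms by (auto simp: partitions_in_def subset_iff member_le_sum_mset)
  then show ?thesis
    by (simp add: partition_fun_def)
qed

lemma partition_fun_singleton_1: "partition_fun {Suc 0} n = 1"
proof -
  have "partitions_in {Suc 0} n = {replicate_mset n 1}"
  proof (intro equalityI subsetI)
    fix P assume "P \<in> partitions_in {Suc 0} n"
    then have P: "set_mset P \<subseteq> {1}" "\<Sum>\<^sub># P = n"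
      by (auto simp: partitions_in_def)
    then have "P = replicate_mset (size P) 1"
      by (metis set_mset_subset_singletonD)
    moreover from this have "\<Sum>\<^sub># P = size P"
      by (metis sum_mset_replicate_mset mult.right_neutral of_nat_id)
    ultimately show "P \<in> {replicate_mset n 1}"
      using P by simp
  qed (auto simp: partitions_in_def)
  then show ?thesis
    by (simp add: partition_fun_def)
qed

lemma partition_fun_pair:
  assumes "u > 1"
  shows "partition_fun {1, u} n = n div u + 1"
proof (induction n rule: less_induct)
  case (less n)
  have "{1, u} - {u} = {1}"
    using assms by auto
  then have "partition_fun {1, u} n = 1 + (if u \<le> n then partition_fun {1, u} (n - u) else 0)"
    using partition_fun_remove[of "{1, u}" u n] assms by (simp add: partition_fun_singleton_1)
  then show ?case
    using less[of "n - u"] assms by (auto simp: le_div_geq)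
qed

section \<open>The family F k: recursion in k and linear lower bounds\<close>

text \<open>The parts 1 and \<open>2 ^ d\<close> stay for every \<open>k\<close>, so each function
  of the family keeps the linear lower bound \<open>tail_count_ge\<close>.\<close>

definition tail_parts :: "nat \<Rightarrow> nat \<Rightarrow> nat set" where
  "tail_parts d k = {1, 2 ^ d} \<union> {j ^ d |j. j \<ge> k}"

definition tail_count :: "nat \<Rightarrow> nat \<Rightarrow> nat \<Rightarrow> nat" where
  "tail_count d k n = partition_fun (tail_parts d k) n"

lemma tail_parts_3: "tail_parts d 3 = perfect_powers d"
proof -
  have "{j :: nat. j > 0} = {1, 2} \<union> {j. j \<ge> 3}"
    by auto
  then have "(\<lambda>j. j ^ d) ` {j. j > 0} = (\<lambda>j. j ^ d) ` ({1, 2} \<union> {j :: nat. j \<ge> 3})"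
    by (rule arg_cong)
  then show ?thesis
    by (simp add: tail_parts_def perfect_powers_def image_Un setcompr_eq_image)
qed

lemma zero_notin_tail_parts: "k \<ge> 3 \<Longrightarrow> 0 \<notin> tail_parts d k"
  by (auto simp: tail_parts_def)

lemma tail_count_base:
  assumes "d \<ge> 2" "k \<ge> 3" "n < k ^ d"
  shows "tail_count d k n = n div 2 ^ d + 1"
proof -
  have "a \<in> tail_parts d k \<longleftrightarrow> a \<in> {1, 2 ^ d}" if "a \<le> n" for a
  proof -
    have "a \<noteq> j ^ d" if "j \<ge> k" for j
      using power_mono[OF that, of d] \<open>a \<le> n\<close> assms by linarith
    then show ?thesis
      by (auto simp: tail_parts_def)
  qed
  then have "tail_count d k n = partition_fun {1, 2 ^ d} n"
    unfolding tail_count_def by (rule partition_fun_cong_le)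
  moreover have "(1 :: nat) < 2 ^ d"
    using assms by (intro one_less_power) auto
  ultimately show ?thesis
    by (simp only: partition_fun_pair)
qed

lemma tail_count_step:
  assumes "d \<ge> 2" "k \<ge> 3" "k ^ d \<le> n"
  shows "tail_count d k n = tail_count d (Suc k) n + tail_count d k (n - k ^ d)"
proof -
  \<comment> \<open>Deleting \<open>k ^ d\<close> must take away neither 1, nor
    \<open>2 ^ d\<close>, nor any later power.\<close>
  have "k ^ d \<noteq> Suc 0" "k ^ d \<noteq> 2 ^ d" "\<And>j. j ^ d = k ^ d \<longleftrightarrow> j = k"
    using assms by (auto simp: power_eq_iff_eq_base)
  then have "tail_parts d k - {k ^ d} = tail_parts d (Suc k)"
    by (fastforce simp: tail_parts_def Suc_le_eq order.order_iff_strict[of k])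
  moreover have "k ^ d \<in> tail_parts d k"
    by (auto simp: tail_parts_def)
  ultimately show ?thesis
    using partition_fun_remove[of "tail_parts d k" "k ^ d" n] assms zero_notin_tail_parts
    by (simp add: tail_count_def)
qed

lemma tail_count_Suc_le:
  assumes "d \<ge> 2" "k \<ge> 3"
  shows "tail_count d (Suc k) n \<le> tail_count d k n"
proof (cases "k ^ d \<le> n")
  case False
  moreover have "k ^ d \<le> Suc k ^ d"
    by (intro power_mono) auto
  ultimately have "n < k ^ d" "n < Suc k ^ d"
    by linarith+
  then show ?thesis
    using assms by (simp add: tail_count_base)
next
  case True
  then show ?thesis
    using tail_count_step[OF assms True] by linarith
qed

text \<open>The step refers to the larger index \<open>Suc k\<close>; this terminates because
  \<open>k <= k ^ d\<close>, so the base case holds as soon as \<open>k > n\<close>.\<close>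

lemma tail_count_induct [consumes 2, case_names base step]:
  assumes "d \<ge> 2" "k \<ge> 3"
  assumes base: "\<And>k. k \<ge> 3 \<Longrightarrow> n < k ^ d \<Longrightarrow> P k"
    and step: "\<And>k. k \<ge> 3 \<Longrightarrow> k ^ d \<le> n \<Longrightarrow> P (Suc k) \<Longrightarrow> P k"
  shows "P k"
  using \<open>k \<ge> 3\<close>
proof (induction "Suc n - k" arbitrary: k rule: less_induct)
  case less
  show ?case
  proof (cases "n < k ^ d")
    case False
    then have "k \<le> n"
      using self_le_power[of k d] less.prems \<open>d \<ge> 2\<close> by linarith
    then have "P (Suc k)"
      using less.prems by (intro less.hyps) simp_all
    then show ?thesis
      using False less.prems step by simp
  qed (use base less.prems in simp)
qed

lemma tail_count_ge:
  assumes "d \<ge> 2" "k \<ge> 3"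
  shows "n div 2 ^ d + 1 \<le> tail_count d k n"
  using assms
proof (induction rule: tail_count_induct[where n = n])
  case (base k)
  then show ?case
    using \<open>d \<ge> 2\<close> by (simp add: tail_count_base)
next
  case (step k)
  then show ?case
    using tail_count_Suc_le[of d k n] \<open>d \<ge> 2\<close> by linarith
qed

text \<open>Partitions without and with a part \<open>k ^ d\<close> are bounded separately. The
  second summand is the gain that pays for extra large parts in \<open>w + z\<close>.\<close>

lemma tail_count_ge_step:
  assumes "d \<ge> 2" "k \<ge> 3" "k ^ d \<le> n"
  shows "n div 2 ^ d + 1 + ((n - k ^ d) div 2 ^ d + 1) \<le> tail_count d k n"
  using tail_count_ge[of d "Suc k" n] tail_count_ge[of d k "n - k ^ d"] tail_count_step[OF assms]
    assms by linarith


section \<open>Quadratic upper bounds for at most two large parts\<close>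

text \<open>The sum \<open>c + (c - 2) + (c - 4) + \<dots>\<close> over its positive terms.\<close>

definition tri :: "nat \<Rightarrow> nat" where
  "tri c = (c + 1)\<^sup>2 div 4"

lemma tri_rec:
  assumes "c > 0"
  shows "tri c = c + tri (c - 2)"
proof (cases "c = 1")
  case False
  define e where "e = c - 2"
  have c: "c = e + 2"
    using assms False by (simp add: e_def)
  have "(c + 1)\<^sup>2 = (e + 1)\<^sup>2 + 4 * c"
    unfolding c by (simp add: power2_eq_square algebra_simps)
  then have "tri c = ((e + 1)\<^sup>2 + 4 * c) div 4"
    by (simp only: tri_def)
  also have "\<dots> = c + tri e"
    by (simp add: tri_def)
  finally show ?thesis
    by (simp add: e_def)
qed (simp add: tri_def power2_eq_square)

lemma tri_mono: "c \<le> e \<Longrightarrow> tri c \<le> tri e"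
  unfolding tri_def by (intro div_le_mono power_mono) auto

lemma four_tri_le: "4 * tri c \<le> (c + 1)\<^sup>2"
  by (simp add: tri_def)

lemma tri_0 [simp]: "tri 0 = 0"
  by (simp add: tri_def)

text \<open>
  For \<open>n \<ge> m\<close> this is \<open>(n - m) div u + 1\<close>, the number of partitions of \<open>n - m\<close> with parts \<open>1\<close> and \<open>u\<close>;
  for \<open>n < m\<close> the truncated subtraction makes it \<open>0\<close>.
\<close>

definition excess :: "nat \<Rightarrow> nat \<Rightarrow> nat \<Rightarrow> nat" where
  "excess u m n = (n + u - m) div u"

lemma excess_eq:
  assumes "u > 0" "m \<le> n"
  shows "excess u m n = (n - m) div u + 1"
proof -
  have "n + u - m = n - m + u"
    using assms by simp
  then have "excess u m n = (n - m + u) div u"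
    by (simp only: excess_def)
  also have "\<dots> = (n - m) div u + 1"
    using assms by (intro div_add_self2) simp
  finally show ?thesis .
qed

lemma excess_shift:
  assumes "u > 0" "m + i * u \<le> m'"
  shows "excess u m' n \<le> excess u m n - i"
proof (cases "m + i * u \<le> n + u")
  case True
  then obtain y where y: "n + u = m + i * u + y"
    using le_Suc_ex by blast
  have "excess u m' n \<le> y div u"
    unfolding excess_def y using assms by (intro div_le_mono) auto
  moreover have "excess u m n = i + y div u"
    unfolding excess_def y using assms by simp
  ultimately show ?thesis
    by simp
next
  case False
  then have "n + u - m' = 0"
    using assms by simp
  then show ?thesis
    by (simp add: excess_def)
qed

text \<open>At most one part \<open>j ^ d\<close> with \<open>j >= k\<close> fits into
  \<open>n\<close>, and it leaves \<open>excess (2 ^ d) (j ^ d) n\<close> choices. By the gap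
  hypothesis this number drops by at least 2 (or to 0) from each \<open>j\<close> to the next, so
  \<open>tri\<close> bounds the sum.\<close>

lemma tail_count_upper_1:
  assumes "d \<ge> 2" "k \<ge> 3"
    and "\<forall>j\<ge>k. j ^ d + 2 * 2 ^ d \<le> Suc j ^ d" "n < 2 * k ^ d"
  shows "tail_count d k n \<le> n div 2 ^ d + 1 + tri (excess (2 ^ d) (k ^ d) n)"
  using assms
proof (induction rule: tail_count_induct[where n = n])
  case (base k)
  then show ?case
    using assms(1) by (simp add: tail_count_base)
next
  case (step k)
  let ?u = "2 ^ d :: nat" and ?m = "k ^ d"
  have gap: "?m + 2 * ?u \<le> Suc k ^ d"
    using step by simp
  have "tail_count d (Suc k) n \<le> n div ?u + 1 + tri (excess ?u (Suc k ^ d) n)"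
    using step gap by (intro step.IH) auto
  also have "tri (excess ?u (Suc k ^ d) n) \<le> tri (excess ?u ?m n - 2)"
    using gap by (intro tri_mono excess_shift) auto
  finally have "tail_count d (Suc k) n \<le> n div ?u + 1 + tri (excess ?u ?m n - 2)"
    by simp
  moreover have "tail_count d k (n - ?m) = excess ?u ?m n"
    using step assms(1) by (simp add: tail_count_base excess_eq)
  moreover have "tri (excess ?u ?m n) = excess ?u ?m n + tri (excess ?u ?m n - 2)"
    using step by (intro tri_rec) (simp add: excess_eq)
  ultimately show ?case
    using tail_count_step[of d k n] step.hyps assms(1) by linarith
qed

text \<open>Two large parts fit only if one of them is \<open>k ^ d\<close>, since
  \<open>n < 2 * Suc k ^ d\<close>. The last summand counts the choices for the other one.\<close>

lemma tail_count_upper_2: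
  assumes "d \<ge> 2" "k \<ge> 3" "\<forall>j\<ge>k. j ^ d + 2 * 2 ^ d \<le> Suc j ^ d"
    and "n < 2 * k ^ d + 4 * 2 ^ d" "4 * 2 ^ d \<le> k ^ d"
  shows "tail_count d k n \<le> n div 2 ^ d + 1 + tri (excess (2 ^ d) (k ^ d) n)
    + tri (excess (2 ^ d) (2 * k ^ d) n)"
  using assms
proof (induction rule: tail_count_induct[where n = n])
  case (base k)
  then show ?case
    using assms(1) by (simp add: tail_count_base)
next
  case (step k)
  let ?u = "2 ^ d :: nat" and ?m = "k ^ d"
  have gap: "?m + 2 * ?u \<le> Suc k ^ d"
    using step by simp
  have "tail_count d (Suc k) n \<le> n div ?u + 1 + tri (excess ?u (Suc k ^ d) n)
      + tri (excess ?u (2 * Suc k ^ d) n)"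
    using step gap by (intro step.IH) auto
  moreover have "tri (excess ?u (Suc k ^ d) n) \<le> tri (excess ?u ?m n - 2)"
    using gap by (intro tri_mono excess_shift) auto
  moreover have "tri (excess ?u (2 * Suc k ^ d) n) = 0"
  proof -
    have "n < 2 * Suc k ^ d"
      using gap step.prems by linarith
    moreover have "0 < ?u"
      by simp
    ultimately have "n + ?u - 2 * Suc k ^ d < ?u"
      by linarith
    then show ?thesis
      by (simp only: excess_def div_less tri_0)
  qed
  moreover have "tail_count d k (n - ?m) \<le> excess ?u ?m n + tri (excess ?u (2 * ?m) n)"
  proof -
    \<comment> \<open>Here \<open>n < 2 * ?m + 4 * ?u <= 3 * ?m\<close>, so \<open>n - ?m\<close>
      has room for only one large part.\<close>
    have "tail_count d k (n - ?m) \<le> (n - ?m) div ?u + 1 + tri (excess ?u ?m (n - ?m))"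
      using step assms(1) by (intro tail_count_upper_1) auto
    moreover have "n - ?m + ?u - ?m = n + ?u - 2 * ?m"
      using step.hyps by linarith
    then have "excess ?u ?m (n - ?m) = excess ?u (2 * ?m) n"
      by (simp only: excess_def)
    moreover have "excess ?u ?m n = (n - ?m) div ?u + 1"
      using step.hyps by (intro excess_eq) simp_all
    ultimately show ?thesis
      by (simp only:)
  qed
  moreover have "tri (excess ?u ?m n) = excess ?u ?m n + tri (excess ?u ?m n - 2)"
    using step by (intro tri_rec) (simp add: excess_eq)
  ultimately show ?case
    using tail_count_step[of d k n] step.hyps assms(1) by linarith
qed

section \<open>Numerical inequalities between \<open>tri\<close> and products\<close>

lemma div_add_le: "(x + y) div u \<le> x div u + y div u + 1" for x y u :: nat
proof (cases "u = 0")
  case False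
  then have "x mod u + y mod u < 2 * u"
    using mod_less_divisor[of u x] mod_less_divisor[of u y] by linarith
  then have "(x mod u + y mod u) div u < 2"
    by (rule less_mult_imp_div_less)
  then show ?thesis
    by (simp add: div_add1_eq[of x y u])
qed simp

lemma div_add_ge: "x div u + y div u \<le> (x + y) div u" for x y u :: nat
  by (simp add: div_add1_eq[of x y u])

text \<open>This amounts to \<open>1 + tri (b + 1) < a * b\<close>, where \<open>tri\<close> grows
  like a quarter of a square. It fails for \<open>a = b = 2\<close>, where it would read 5 <
  4.\<close>

lemma tri_bound_one_part:
  assumes "2 \<le> b" "b \<le> a" "3 \<le> a"
  shows "a + b + 2 + tri (b + 1) < (a + 1) * (b + 1)"
proof (cases "b = 2")
  case True
  then show ?thesis
    using assms by (simp add: tri_def power2_eq_square)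
next
  case False
  then have "3 \<le> b"
    using assms by simp
  then obtain i j where "b = 3 + i" "a = 3 + i + j"
    using assms le_iff_add by metis
  then show ?thesis
    using four_tri_le[of "b + 1"] by (simp add: power2_eq_square algebra_simps)
qed

text \<open>For the case \<open>z < m <= w\<close> with \<open>e = (w - m) div u\<close>: the factor
  \<open>a + e + 2\<close> is the bound of \<open>tail_count_ge_step\<close> for
  \<open>w\<close>.\<close>

lemma tri_bound_two_parts:
  assumes "2 \<le> b" "b + e \<le> a" "4 + e \<le> a" "e \<le> 1"
  shows "a + b + 2 + tri (e + b + 2) + tri (e + 1) < (a + e + 2) * (b + 1)"
proof (cases "b = 2")
  case True
  then show ?thesis
    using assms by (auto simp: tri_def power2_eq_square le_Suc_eq)
next
  case False
  then have "3 \<le> b"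
    using assms by simp
  then obtain i j where "b = 3 + i" "a = 3 + i + e + j"
    using assms le_iff_add by metis
  moreover have "e = 0 \<or> e = 1"
    using assms by auto
  moreover have "tri (Suc 0) = 1" "tri (Suc (Suc 0)) = 2"
    by (simp_all add: tri_def power2_eq_square)
  ultimately show ?thesis
    using four_tri_le[of "e + b + 2"] by (auto simp: power2_eq_square algebra_simps)
qed

lemma tri_bound_square:
  assumes "4 \<le> b" "b \<le> a" "e \<le> 1" "f \<le> 1"
  shows "a + b + 2 + tri (e + b + 2) + tri (e + f + 2) < (a + e + 2) * (b + f + 2)"
proof -
  obtain i j where "b = 4 + i" "a = 4 + i + j"
    using assms le_iff_add by metis
  moreover have "e = 0 \<or> e = 1" "f = 0 \<or> f = 1"
    using assms by auto
  moreover have "tri (Suc (Suc 0)) = 2" "tri (Suc (Suc (Suc 0))) = 4" "tri (Suc (Suc (Suc (Suc 0)))) = 6"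
    by (simp_all add: tri_def power2_eq_square)
  ultimately show ?thesis
    using four_tri_le[of "e + b + 2"] by (auto simp: power2_eq_square algebra_simps)
qed

section \<open>The inequality for arguments below \<open>k ^ d + 2 * 2 ^ d\<close>\<close>

lemma tail_count_supermult_small:
  assumes "d \<ge> 2" "k \<ge> 3" "\<forall>j\<ge>k. j ^ d + 2 * 2 ^ d \<le> Suc j ^ d"
    and m: "4 * 2 ^ d \<le> k ^ d" and m': "6 * 2 ^ d \<le> Suc k ^ d"
    and wz: "2 * 2 ^ d \<le> z" "z \<le> w" "w < k ^ d + 2 * 2 ^ d"
  shows "tail_count d k (w + z) \<le> tail_count d k w * tail_count d k z \<and>
    (3 * 2 ^ d \<le> w \<longrightarrow> tail_count d k (w + z) < tail_count d k w * tail_count d k z)"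
proof -
  define u :: nat where "u = 2 ^ d"
  define m where "m = k ^ d"
  define a where "a = w div u"
  define b where "b = z div u"
  let ?F = "tail_count d k"
  have u: "u > 0"
    by (simp add: u_def)
  note facts = assms(3-)[folded u_def m_def]
  have ab: "b \<le> a" "2 \<le> b"
    unfolding a_def b_def using facts u
    by (intro div_le_mono, simp_all add: less_eq_div_iff_mult_less_eq)
  have sum: "(w + z) div u \<le> a + b + 1"
    unfolding a_def b_def by (rule div_add_le)
  have ge: "a + 1 \<le> ?F w" "b + 1 \<le> ?F z"
    using tail_count_ge[OF assms(1,2)] by (simp_all add: a_def b_def u_def)
  have upper: "?F (w + z) \<le> (w + z) div u + 1 + tri (excess u m (w + z)) + tri (excess u (2 * m) (w + z))"
    unfolding u_def m_def using facts[unfolded u_def m_def] assms(1,2) by (intro tail_count_upper_2) auto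
  \<comment> \<open>The split is by how many of \<open>w\<close>, \<open>z\<close> reach
    \<open>m\<close>; if neither does, the pair \<open>a = b = 2\<close> excluded by
    \<open>tri_bound_one_part\<close> is set apart.\<close>
  consider "w < m" "a \<ge> 3" | "w < m" "a = 2" "b = 2" | "z < m" "m \<le> w" | "m \<le> z" "m \<le> w"
    using ab facts by linarith
  then show ?thesis
  proof cases
    case 1
    have "excess u m (w + z) \<le> b + 1"
    proof -
      have "excess u m (w + z) \<le> (z + u) div u"
        unfolding excess_def using 1 by (intro div_le_mono) simp
      then show ?thesis
        using u by (simp add: b_def)
    qed
    then have "tri (excess u m (w + z)) \<le> tri (b + 1)"
      by (rule tri_mono)
    moreover have "excess u (2 * m) (w + z) = 0"
      unfolding excess_def using 1 facts u by (intro div_less) linarith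
    ultimately have "?F (w + z) \<le> a + b + 2 + tri (b + 1)"
      using upper sum by simp
    also have "\<dots> < (a + 1) * (b + 1)"
      using ab 1 by (intro tri_bound_one_part)
    also have "\<dots> \<le> ?F w * ?F z"
      using ge by (intro mult_mono) auto
    finally show ?thesis
      by simp
  next
    \<comment> \<open>The bound by \<open>tri 3\<close> is too weak here, but \<open>w + z\<close> is too small for a part above \<open>m\<close>.\<close>
    case 2
    have "w < 3 * u" "z < 3 * u"
      using 2 u dividend_less_div_times[of u w] dividend_less_div_times[of u z]
      by (simp_all add: a_def b_def)
    then have n: "w + z < Suc k ^ d"
      using facts by linarith
    have "?F (w + z) \<le> 9"
    proof (cases "w + z < m")
      case True
      then show ?thesis
        using assms(1,2) sum 2 by (simp add: tail_count_base m_def u_def)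
    next
      case False
      have "(w + z - m) div u \<le> b"
        unfolding b_def using 2 by (intro div_le_mono) simp
      moreover have "?F (w + z) = tail_count d (Suc k) (w + z) + ?F (w + z - m)"
        unfolding m_def using assms(1,2) False by (intro tail_count_step) (simp_all add: m_def)
      moreover have "tail_count d (Suc k) (w + z) = (w + z) div u + 1"
        unfolding u_def using assms(1,2) n by (intro tail_count_base) auto
      moreover have "?F (w + z - m) = (w + z - m) div u + 1"
        unfolding u_def using assms(1,2) 2 facts by (intro tail_count_base) (auto simp: m_def)
      ultimately show ?thesis
        using sum 2 by linarith
    qed
    moreover have "3 * 3 \<le> ?F w * ?F z"
      using ge 2 by (intro mult_mono) auto
    \<comment> \<open>So the strict half of the claim is vacuous in this case.\<close>
    moreover have "\<not> 3 * u \<le> w"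
      using \<open>w < 3 * u\<close> by simp
    ultimately show ?thesis
      by (simp add: u_def)
  next
    case 3
    define e where "e = (w - m) div u"
    have e: "e \<le> 1"
      unfolding e_def using facts u 3 by (simp add: less_Suc_eq_le[symmetric] div_less_iff_less_mult)
    \<comment> \<open>From \<open>w = m + (w - m)\<close> and \<open>4 * u <= m\<close>.\<close>
    have "4 + e \<le> a"
    proof -
      have "4 + e = (w - m + 4 * u) div u"
        using u by (simp add: e_def)
      also have "\<dots> \<le> a"
        unfolding a_def using facts 3 by (intro div_le_mono) linarith
      finally show ?thesis .
    qed
    have "b + e \<le> a"
    proof -
      have "b + e \<le> (z + (w - m)) div u"
        unfolding b_def e_def by (rule div_add_ge)
      also have "\<dots> \<le> a"
        unfolding a_def using 3 by (intro div_le_mono) linarith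
      finally show ?thesis .
    qed
    have "excess u m (w + z) \<le> e + b + 2"
    proof -
      have "excess u m (w + z) = (w + z - m) div u + 1"
        using 3 u by (intro excess_eq) auto
      also have "w + z - m = (w - m) + z"
        using 3 by simp
      also have "\<dots> div u \<le> e + b + 1"
        unfolding e_def b_def by (rule div_add_le)
      finally show ?thesis
        by simp
    qed
    then have "tri (excess u m (w + z)) \<le> tri (e + b + 2)"
      by (rule tri_mono)
    moreover have "excess u (2 * m) (w + z) \<le> e + 1"
    proof -
      have "excess u (2 * m) (w + z) \<le> (w - m + u) div u"
        unfolding excess_def using 3 by (intro div_le_mono) linarith
      then show ?thesis
        using u by (simp add: e_def)
    qed
    then have "tri (excess u (2 * m) (w + z)) \<le> tri (e + 1)"
      by (rule tri_mono)
    ultimately have "?F (w + z) \<le> a + b + 2 + tri (e + b + 2) + tri (e + 1)"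
      using upper sum by linarith
    also have "\<dots> < (a + e + 2) * (b + 1)"
      using ab e \<open>4 + e \<le> a\<close> \<open>b + e \<le> a\<close> by (intro tri_bound_two_parts)
    also have "\<dots> \<le> ?F w * ?F z"
    proof (intro mult_mono)
      show "a + e + 2 \<le> ?F w"
        using tail_count_ge_step[OF assms(1,2), of w] 3 by (simp add: a_def e_def m_def u_def)
    qed (use ge in auto)
    finally show ?thesis
      by simp
  next
    case 4
    define e where "e = (w - m) div u"
    define f where "f = (z - m) div u"
    have e: "e \<le> 1" and f: "f \<le> 1"
      unfolding e_def f_def using facts u 4
      by (simp_all add: less_Suc_eq_le[symmetric] div_less_iff_less_mult)
    have "4 \<le> b"
      unfolding b_def using facts u 4 by (simp add: less_eq_div_iff_mult_less_eq)
    have "excess u m (w + z) \<le> e + b + 2"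
    proof -
      have "excess u m (w + z) = (w + z - m) div u + 1"
        using 4 u by (intro excess_eq) auto
      also have "w + z - m = (w - m) + z"
        using 4 by simp
      also have "\<dots> div u \<le> e + b + 1"
        unfolding e_def b_def by (rule div_add_le)
      finally show ?thesis
        by simp
    qed
    then have "tri (excess u m (w + z)) \<le> tri (e + b + 2)"
      by (rule tri_mono)
    moreover have "excess u (2 * m) (w + z) \<le> e + f + 2"
    proof -
      have "excess u (2 * m) (w + z) = (w + z - 2 * m) div u + 1"
        using 4 u by (intro excess_eq) auto
      also have "w + z - 2 * m = (w - m) + (z - m)"
        using 4 by simp
      also have "\<dots> div u \<le> e + f + 1"
        unfolding e_def f_def by (rule div_add_le)
      finally show ?thesis
        by simp
    qed
    then have "tri (excess u (2 * m) (w + z)) \<le> tri (e + f + 2)"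
      by (rule tri_mono)
    ultimately have "?F (w + z) \<le> a + b + 2 + tri (e + b + 2) + tri (e + f + 2)"
      using upper sum by linarith
    also have "\<dots> < (a + e + 2) * (b + f + 2)"
      using ab e f \<open>4 \<le> b\<close> by (intro tri_bound_square)
    also have "\<dots> \<le> ?F w * ?F z"
    proof (intro mult_mono)
      show "a + e + 2 \<le> ?F w"
        using tail_count_ge_step[OF assms(1,2), of w] 4 by (simp add: a_def e_def m_def u_def)
      show "b + f + 2 \<le> ?F z"
        using tail_count_ge_step[OF assms(1,2), of z] 4 by (simp add: b_def f_def m_def u_def)
    qed auto
    finally show ?thesis
      by simp
  qed
qed


section \<open>Gaps between consecutive powers\<close>

text \<open>Induction on the exponent. The excluded pair \<open>d = 2\<close>, \<open>j = 3\<close>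
  does fail: 9 + 8 > 16.\<close>

lemma power_Suc_gap:
  assumes "d \<ge> 2" "j \<ge> 3" "d \<ge> 3 \<or> j \<ge> 4"
  shows "j ^ d + 2 * 2 ^ d \<le> Suc j ^ d"
proof -
  have step: "j ^ Suc e + 2 * 2 ^ Suc e \<le> Suc j ^ Suc e" if "j ^ e + 2 * 2 ^ e \<le> Suc j ^ e" for e
  proof -
    have "2 * (2 * 2 ^ e) \<le> Suc j * (2 * 2 ^ e)"
      using assms(2) by (intro mult_right_mono) auto
    moreover have "Suc j * (j ^ e + 2 * 2 ^ e) = j * j ^ e + j ^ e + Suc j * (2 * 2 ^ e)"
      by (simp add: algebra_simps)
    ultimately have "j * j ^ e + 2 * (2 * 2 ^ e) \<le> Suc j * (j ^ e + 2 * 2 ^ e)"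
      by linarith
    also have "\<dots> \<le> Suc j * Suc j ^ e"
      using that by (rule mult_left_mono) simp
    finally show ?thesis
      by simp
  qed
  show ?thesis
  proof (cases "j \<ge> 4")
    case True
    show ?thesis
      using assms(1)
    proof (induction d rule: nat_induct_at_least)
      case base
      show ?case
        using True by (simp add: power2_eq_square)
    qed (rule step)
  next
    case False
    then have "d \<ge> 3" "j = 3"
      using assms by auto
    from this(1) show ?thesis
    proof (induction d rule: nat_induct_at_least)
      case base
      show ?case
        using \<open>j = 3\<close> by simp
    qed (rule step)
  qed
qed

text \<open>For \<open>j = 3\<close> the exponents 2 and 3 fail (16 > 9 and 32 > 27), hence the two
  computed cases below.\<close>

lemma four_mult_power_le:
  fixes d j :: nat
  assumes "d \<ge> 2" "j \<ge> 3" "d \<ge> 4 \<or> j \<ge> 4"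
  shows "4 * 2 ^ d \<le> j ^ d"
proof (cases "j \<ge> 4")
  case True
  have "(2 :: nat) ^ 2 * 2 ^ d \<le> 2 ^ d * 2 ^ d"
    using assms(1) by (intro mult_right_mono power_increasing) auto
  also have "\<dots> = 4 ^ d"
    by (simp flip: power_mult_distrib)
  also have "\<dots> \<le> j ^ d"
    using True by (intro power_mono) auto
  finally show ?thesis
    by simp
next
  case False
  then have "d \<ge> 4" "j = 3"
    using assms by auto
  from this(1) have "4 * 2 ^ d \<le> (3 :: nat) ^ d"
    by (induction d rule: nat_induct_at_least) auto
  then show ?thesis
    using \<open>j = 3\<close> by simp
qed

section \<open>Supermultiplicativity by induction\<close>

text \<open>
  Strictness can fail for \<open>w, z < 3 * 2 ^ d\<close>: for \<open>d = 3\<close> and \<open>w = z = 23\<close> both sides are \<open>9\<close>. The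
  weak inequality below that threshold is what the induction needs for \<open>w - k ^ d\<close>.
\<close>

definition supermult :: "nat \<Rightarrow> nat \<Rightarrow> nat \<Rightarrow> nat \<Rightarrow> bool" where
  "supermult d k w z \<longleftrightarrow> tail_count d k (w + z) \<le> tail_count d k w * tail_count d k z \<and>
    (3 * 2 ^ d \<le> w \<or> 3 * 2 ^ d \<le> z \<longrightarrow>
      tail_count d k (w + z) < tail_count d k w * tail_count d k z)"

lemma supermult_commute: "supermult d k w z \<longleftrightarrow> supermult d k z w"
  by (auto simp: supermult_def ac_simps)

text \<open>The range is from \<open>2 * 2 ^ d\<close> to below \<open>3 ^ d + 2 * 2 ^ d\<close> at
  \<open>d = 2\<close>; unfolding the recursion evaluates every pair.\<close>

lemma supermult_2_3:
  assumes "8 \<le> w" "w < 17" "8 \<le> z" "z < 17"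
  shows "supermult 2 3 w z"
proof -
  have "\<forall>w\<in>set [8..<17]. \<forall>z\<in>set [8..<17]. supermult 2 3 w z"
    by (simp add: supermult_def tail_count_base tail_count_step)
  moreover have "w \<in> set [8..<17]" "z \<in> set [8..<17]"
    using assms by (simp_all only: set_upt atLeastLessThan_iff)
  ultimately show ?thesis
    by blast
qed

lemma supermult_3_3:
  assumes "16 \<le> w" "w < 43" "16 \<le> z" "z < 43"
  shows "supermult 3 3 w z"
proof -
  have "\<forall>w\<in>set [16..<43]. \<forall>z\<in>set [16..<43]. supermult 3 3 w z"
    by (simp add: supermult_def tail_count_base tail_count_step)
  moreover have "w \<in> set [16..<43]" "z \<in> set [16..<43]"
    using assms by (simp_all only: set_upt atLeastLessThan_iff)
  ultimately show ?thesis
    by blast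
qed

lemma supermult_step:
  assumes "d \<ge> 2" "k \<ge> 3" "k ^ d \<le> w"
    and "supermult d k (w - k ^ d) z" "supermult d (Suc k) w z"
  shows "supermult d k w z"
proof -
  let ?F = "tail_count d k" and ?G = "tail_count d (Suc k)"
  have F: "?F (w + z) = ?G (w + z) + ?F (w - k ^ d + z)" "?F w = ?G w + ?F (w - k ^ d)"
    using assms by (simp_all add: tail_count_step)
  have le: "?F (w - k ^ d + z) \<le> ?F (w - k ^ d) * ?F z"
    "?G (w + z) \<le> ?G w * ?G z"
    using assms by (simp_all add: supermult_def)
  have G: "?G w * ?G z \<le> ?G w * ?F z"
    using assms by (intro mult_left_mono tail_count_Suc_le) auto
  show ?thesis
    unfolding supermult_def
  proof (intro conjI impI)
    show "?F (w + z) \<le> ?F w * ?F z"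
      unfolding F add_mult_distrib using le G by linarith
    assume "3 * 2 ^ d \<le> w \<or> 3 * 2 ^ d \<le> z"
    \<comment> \<open>Strictness is drawn from \<open>Suc k\<close> alone, because
      \<open>w - k ^ d\<close> may lie below the threshold.\<close>
    then have "?G (w + z) < ?G w * ?G z"
      using assms by (simp add: supermult_def)
    then show "?F (w + z) < ?F w * ?F z"
      unfolding F add_mult_distrib using le G by linarith
  qed
qed

lemma supermult_small:
  assumes "d \<ge> 2" "k \<ge> 3" "2 * 2 ^ d \<le> w" "2 * 2 ^ d \<le> z"
    and "w < k ^ d + 2 * 2 ^ d" "z < k ^ d + 2 * 2 ^ d"
  shows "supermult d k w z"
proof -
  consider "k = 3" "d = 2" | "k = 3" "d = 3" | "d \<ge> 4 \<or> k \<ge> 4"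
    using assms(1,2) by linarith
  then show ?thesis
  proof cases
    case 1
    then show ?thesis
      using assms supermult_2_3 by simp
  next
    case 2
    then show ?thesis
      using assms supermult_3_3 by simp
  next
    case 3
    have gap: "\<forall>j\<ge>k. j ^ d + 2 * 2 ^ d \<le> Suc j ^ d"
      using assms(1,2) 3 by (intro allI impI power_Suc_gap) auto
    have four: "4 * 2 ^ d \<le> k ^ d"
      using assms(1,2) 3 by (intro four_mult_power_le)
    have "k ^ d + 2 * 2 ^ d \<le> Suc k ^ d"
      using gap by simp
    then have six: "6 * 2 ^ d \<le> Suc k ^ d"
      using four by linarith
    have *: "supermult d k x y"
      if "y \<le> x" "2 * 2 ^ d \<le> y" "x < k ^ d + 2 * 2 ^ d" for x y
    proof -
      have "3 * 2 ^ d \<le> x \<or> 3 * 2 ^ d \<le> y \<longleftrightarrow> 3 * 2 ^ d \<le> x"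
        using that by linarith
      then show ?thesis
        using tail_count_supermult_small[OF assms(1,2) gap four six that(2,1,3)]
        unfolding supermult_def by blast
    qed
    show ?thesis
    proof (cases "z \<le> w")
      case True
      then show ?thesis
        using assms by (intro *)
    next
      case False
      then show ?thesis
        using assms by (subst supermult_commute, intro *) simp_all
    qed
  qed
qed

lemma supermult:
  assumes "d \<ge> 2" "k \<ge> 3" "2 * 2 ^ d \<le> w" "2 * 2 ^ d \<le> z"
  shows "supermult d k w z"
  using assms(2-)
\<comment> \<open>Both raising \<open>k\<close> and subtracting \<open>k ^ d\<close> from an
  argument lower this measure; in the reduction \<open>k < 2 * (w + z)\<close>, so truncation does
  no harm.\<close>
proof (induction "2 * (w + z) - k" arbitrary: k w z rule: less_induct)
  case less
  have reduce: "supermult d k x y"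
    if "x + y = w + z" "2 * 2 ^ d \<le> y" "k ^ d + 2 * 2 ^ d \<le> x" for x y
  proof (rule supermult_step)
    have k: "k \<le> k ^ d"
      using assms(1) less.prems(1) by (intro self_le_power) auto
    show "k ^ d \<le> x"
      using that(3) by (rule add_leD1)
    have "2 * (x - k ^ d + y) < 2 * (w + z)" "k < 2 * (w + z)"
      using less.prems(1) that(1) k \<open>k ^ d \<le> x\<close> by simp_all
    then show "supermult d k (x - k ^ d) y"
      using less.prems(1) that by (intro less.hyps) linarith+
    have "2 * (x + y) - Suc k < 2 * (w + z) - k"
      using \<open>k < 2 * (w + z)\<close> that(1) by simp
    then show "supermult d (Suc k) x y"
      using less.prems(1) that by (intro less.hyps) linarith+
  qed (use assms(1) less.prems in auto)
  consider "k ^ d + 2 * 2 ^ d \<le> w" | "k ^ d + 2 * 2 ^ d \<le> z"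
    | "w < k ^ d + 2 * 2 ^ d" "z < k ^ d + 2 * 2 ^ d"
    by linarith
  then show ?case
  proof cases
    case 1
    then show ?thesis
      using less.prems by (intro reduce) simp_all
  next
    case 2
    then show ?thesis
      using less.prems by (subst supermult_commute, intro reduce) simp_all
  next
    case 3
    then show ?thesis
      using less.prems assms(1) by (intro supermult_small)
  qed
qed

lemma partition_fun_perfect_powers_less:
  assumes "d \<ge> 2" "3 * 2 ^ d \<le> w" "3 * 2 ^ d \<le> z"
  shows "partition_fun (perfect_powers d) (w + z)
    < partition_fun (perfect_powers d) w * partition_fun (perfect_powers d) z"
  using supermult[of d 3 w z] assms by (simp add: supermult_def tail_count_def tail_parts_3)

theorem theorem5p2:
  shows "(\<forall>d w z :: nat. d \<ge> 3 \<and> w \<ge> 3 ^ d \<and> z \<ge> 3 ^ d \<longrightarrow>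
            partition_fun (perfect_powers d) w * partition_fun (perfect_powers d) z
              > partition_fun (perfect_powers d) (w + z))
       \<and> (\<forall>w z :: nat. w \<ge> 12 \<and> z \<ge> 12 \<longrightarrow>
            partition_fun (perfect_powers 2) w * partition_fun (perfect_powers 2) z
              > partition_fun (perfect_powers 2) (w + z))"
proof (intro conjI allI impI)
  fix d w z :: nat
  assume *: "d \<ge> 3 \<and> w \<ge> 3 ^ d \<and> z \<ge> 3 ^ d"
  then have "d \<ge> 3"
    by simp
  \<comment> \<open>The base case is 24 <= 27. For \<open>d = 2\<close> the threshold
    \<open>3 * 2 ^ d\<close> is the stated 12 itself.\<close>
  then have "3 * 2 ^ d \<le> (3 :: nat) ^ d"
    by (induction d rule: nat_induct_at_least) auto
  then show "partition_fun (perfect_powers d) w * partition_fun (perfect_powers d) z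
      > partition_fun (perfect_powers d) (w + z)"
    using * by (intro partition_fun_perfect_powers_less) linarith+
qed (auto intro!: partition_fun_perfect_powers_less)

end
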